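(* Let $p$ be a positive integer. Let $\mathbf{L}\subset\mathbb{R}^p$ be the lattice generated by $\mathbf{M}_p^* = \frac{\sqrt{p+1}}{\sqrt{p}}\,\mathbf{I}_p - \frac{1}{\sqrt{p}(\sqrt{p+1}-1)}\,\mathbf{J}_p$ and let $\mathbf{K}$ be the lattice generated by $\{2(p+1)/p\}^{1/2}\,\mathbf{M}_p$, where $\mathbf{M}_p = \frac{\sqrt{2}}{2}\,\mathbf{I}_p - \frac{\sqrt{p+1}+1}{\sqrt{2}\,p}\,\mathbf{J}_p$. For $j\in\{0,\ldots,p\}$ let $\mathbf{u}_j\in\mathbb{Z}^p$ be the vector whose first $j$ entries are $1$ and whose other entries are $0$. Suppose $\mathbf{a}=(a_1,\ldots,a_p)^T\in\mathbb{Z}^p$ and let $z\in\{0,\ldots,p\}$ be the residue of $\sum_{i=1}^p a_i$ modulo $p+1$. Then $\mathbf{a}^T\mathbf{M}_p^* \in \mathbf{K}\oplus \mathbf{u}_z^T\mathbf{M}_p^*$. Furthermore, $\{\mathbf{K}\oplus \mathbf{u}_0^T\mathbf{M}_p^*,\ldots,\mathbf{K}\oplus \mathbf{u}_p^T\mathbf{M}_p^*\}$ is a partition of $\mathbf{L}$ (into $p+1$ cosets of $\mathbf{K}$).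
   Context: $\mathbf{I}_p$ is the $p\times p$ identity matrix and $\mathbf{J}_p$ is the $p\times p$ matrix with all entries equal to one. The lattice generated by a $p\times p$ matrix $\mathbf{G}$ is the set of all integer linear combinations of the rows of $\mathbf{G}$, i.e. $\{\mathbf{a}^T\mathbf{G}:\mathbf{a}\in\mathbb{Z}^p\}$ (points are row vectors). For a set $\mathbf{K}$ and a point $\mathbf{q}$, $\mathbf{K}\oplus\mathbf{q}=\{\mathbf{k}+\mathbf{q}:\mathbf{k}\in\mathbf{K}\}$. *)

theory Defs
  imports Complex_Main "HOL-Library.Disjoint_Sets" "Jordan_Normal_Form.Matrix"
begin

definition J_mat :: "nat \<Rightarrow> real mat" where
  "J_mat p = mat p p (\<lambda>_. 1)"

definition M_star :: "nat \<Rightarrow> real mat" where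
  "M_star p = (sqrt (real p + 1) / sqrt (real p)) \<cdot>\<^sub>m 1\<^sub>m p
              - (1 / (sqrt (real p) * (sqrt (real p + 1) - 1))) \<cdot>\<^sub>m J_mat p"

definition M_mat :: "nat \<Rightarrow> real mat" where
  "M_mat p = (sqrt 2 / 2) \<cdot>\<^sub>m 1\<^sub>m p
             - ((sqrt (real p + 1) + 1) / (sqrt 2 * real p)) \<cdot>\<^sub>m J_mat p"

text \<open>The row vector \<open>a\<^sup>T G\<close> for an integer vector \<open>a\<close>. Vectors here carry no row/column
  orientation, so it is rendered as the transpose of \<open>G\<close> applied to \<open>a\<close>.\<close>

definition int_row_comb :: "int vec \<Rightarrow> real mat \<Rightarrow> real vec" where
  "int_row_comb a G = transpose_mat G *\<^sub>v map_vec real_of_int a"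

definition lattice_of_mat :: "real mat \<Rightarrow> real vec set" where
  "lattice_of_mat G = {int_row_comb a G | a. a \<in> carrier_vec (dim_row G)}"

definition translate :: "real vec set \<Rightarrow> real vec \<Rightarrow> real vec set" (infixl \<open>\<oplus>\<^sub>t\<close> 65) where
  "K \<oplus>\<^sub>t q = {k + q | k. k \<in> K}"

text \<open>Vector entries are indexed from 0, so the first \<open>j\<close> entries are those with index
  \<open>i < j\<close>.\<close>

definition u_vec :: "nat \<Rightarrow> nat \<Rightarrow> int vec" where
  "u_vec p j = vec p (\<lambda>i. if i < j then 1 else 0)"

end

theory Submission
  imports Defs
begin

text \<open>
  With \<open>s = sqrt (p + 1)\<close> the rescaled \<open>M_mat p\<close> equals
  \<open>(s / sqrt p) (I - J / (s - 1))\<close>, whence \<open>b\<^sup>T\<close> times it is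
  \<open>(b + T 1)\<^sup>T M_star p\<close> with \<open>T\<close> the coordinate sum of \<open>b\<close>. As \<open>b + T 1\<close> has coordinate
  sum \<open>(p + 1) T\<close>, the lattice \<open>K\<close> consists of the points \<open>a\<^sup>T M_star p\<close> with
  \<open>\<Sum>a \<equiv> 0 (mod p + 1)\<close>. Since \<open>M_star p\<close> is injective on integer vectors, the translates are
  the images of the fibres of \<open>a \<mapsto> \<Sum>a mod (p + 1)\<close>.
\<close>

section \<open>Coordinates of points generated by \<open>x I - y J\<close>, and injectivity for
  \<open>M_star p\<close>\<close>

lemma int_row_comb_I_J_nth:
  assumes "a \<in> carrier_vec p" "i < p"
  shows "int_row_comb a (x \<cdot>\<^sub>m 1\<^sub>m p - y \<cdot>\<^sub>m J_mat p) $ i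
    = x * real_of_int (a $ i) - y * real_of_int (\<Sum>k<p. a $ k)"
proof -
  have "int_row_comb a (x \<cdot>\<^sub>m 1\<^sub>m p - y \<cdot>\<^sub>m J_mat p) $ i
      = (\<Sum>k = 0..<p. (x * (if k = i then 1 else 0) - y) * real_of_int (a $ k))"
    using assms unfolding int_row_comb_def J_mat_def
    by (auto simp: scalar_prod_def intro!: sum.cong)
  also have "\<dots> = (\<Sum>k = 0..<p. (if k = i then x * real_of_int (a $ k) else 0) - y * real_of_int (a $ k))"
    by (intro sum.cong) (auto simp: algebra_simps)
  also have "\<dots> = x * real_of_int (a $ i) - y * (\<Sum>k = 0..<p. real_of_int (a $ k))"
    using assms(2) by (simp add: sum_subtractf sum_distrib_left)
  finally show ?thesis
    by (simp add: atLeast0LessThan)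
qed

text \<open>The single common denominator, nonzero for \<open>p > 0\<close>, lets two points be
  compared through their numerators alone.\<close>

lemma int_row_comb_M_star_nth:
  assumes "a \<in> carrier_vec p" "i < p"
  shows "int_row_comb a (M_star p) $ i
    = (sqrt (real p + 1) * (sqrt (real p + 1) - 1) * real_of_int (a $ i) - real_of_int (\<Sum>k<p. a $ k))
      / (sqrt (real p) * (sqrt (real p + 1) - 1))"
proof -
  have frac: "s / t * x - 1 / (t * (s - 1)) * y = (s * (s - 1) * x - y) / (t * (s - 1))"
    if "s \<noteq> 1" "t \<noteq> 0" for s t x y :: real
  proof -
    have "s * (s - 1) * x / (t * (s - 1)) = s / t * x"
      using that(1) by simp
    then show ?thesis
      by (simp only: diff_divide_distrib mult_1 times_divide_eq_left)
  qed
  have "sqrt (real p + 1) \<noteq> 1" "sqrt (real p) \<noteq> 0"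
    using assms(2) by auto
  then show ?thesis
    unfolding M_star_def int_row_comb_I_J_nth[OF assms] by (rule frac)
qed

lemma M_star_carrier: "M_star p \<in> carrier_mat p p"
  by (auto simp: M_star_def J_mat_def)

lemma int_row_comb_M_star_carrier [simp]: "int_row_comb a (M_star p) \<in> carrier_vec p"
  using M_star_carrier[of p] unfolding int_row_comb_def carrier_vec_def by simp

lemma int_row_comb_add:
  assumes "G \<in> carrier_mat n m" "a \<in> carrier_vec n" "b \<in> carrier_vec n"
  shows "int_row_comb (a + b) G = int_row_comb a G + int_row_comb b G"
proof -
  have "map_vec real_of_int (a + b) = map_vec real_of_int a + map_vec real_of_int b"
    using assms by (intro eq_vecI) auto
  then show ?thesis
    using assms unfolding int_row_comb_def
    by (simp add: mult_add_distrib_mat_vec[of _ m n])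
qed

text \<open>If two images agree, all coordinate differences are the same multiple of the difference
  \<open>D\<close> of the coordinate sums; adding them up forces \<open>D = 0\<close>. Injectivity
  later keeps different residue classes apart in \<open>L\<close>.\<close>

lemma inj_on_int_row_comb_M_star:
  assumes "0 < p"
  shows "inj_on (\<lambda>a. int_row_comb a (M_star p)) (carrier_vec p)"
proof (rule inj_onI)
  fix a b :: "int vec"
  assume a: "a \<in> carrier_vec p" and b: "b \<in> carrier_vec p"
    and eq: "int_row_comb a (M_star p) = int_row_comb b (M_star p)"
  define s where "s = sqrt (real p + 1)"
  define D where "D = real_of_int (\<Sum>k<p. a $ k) - real_of_int (\<Sum>k<p. b $ k)"
  have s: "s > 1" "s * s = real p + 1"
    using assms unfolding s_def by auto
  have *: "s * (s - 1) * (real_of_int (a $ i) - real_of_int (b $ i)) = D" if "i < p" for i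
  proof -
    have "sqrt (real p) * (s - 1) \<noteq> 0"
      using s(1) assms by simp
    then have "s * (s - 1) * real_of_int (a $ i) - real_of_int (\<Sum>k<p. a $ k)
        = s * (s - 1) * real_of_int (b $ i) - real_of_int (\<Sum>k<p. b $ k)"
      using arg_cong[OF eq, of "\<lambda>v. v $ i"]
      unfolding int_row_comb_M_star_nth[OF a that] int_row_comb_M_star_nth[OF b that]
        s_def[symmetric]
      by (metis nonzero_eq_divide_eq)
    then show ?thesis
      unfolding D_def right_diff_distrib by linarith
  qed
  \<comment> \<open>Sum \<open>*\<close> over all \<open>p\<close> coordinates: the left sides add
    up to \<open>s * (s - 1) * D\<close>, the right sides to \<open>p * D\<close>, where
    \<open>p = s * s - 1\<close>. The two factors differ by \<open>s - 1\<close>, which is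
    nonzero.\<close>
  have "s * (s - 1) * D = (\<Sum>i<p. s * (s - 1) * (real_of_int (a $ i) - real_of_int (b $ i)))"
    unfolding D_def by (simp add: sum_subtractf flip: sum_distrib_left)
  also have "\<dots> = (s * s - 1) * D"
    using * s(2) by simp
  finally have "(s - 1) * D = 0"
    by (simp add: algebra_simps)
  then have "D = 0"
    using s(1) by simp
  then have "a $ i = b $ i" if "i < p" for i
    using *[OF that] s(1) by simp
  then show "a = b"
    using a b by (intro eq_vecI) auto
qed

section \<open>Description of \<open>K\<close> through \<open>M_star p\<close>\<close>

lemma scaled_M_mat:
  assumes "0 < p"
  shows "sqrt (2 * (real p + 1) / real p) \<cdot>\<^sub>m M_mat p
    = (sqrt (real p + 1) / sqrt (real p)) \<cdot>\<^sub>m 1\<^sub>m p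
      - (sqrt (real p + 1) / (sqrt (real p) * (sqrt (real p + 1) - 1))) \<cdot>\<^sub>m J_mat p"
proof -
  define s where "s = sqrt (real p + 1)"
  have s: "s > 1" "real p = (s - 1) * (s + 1)"
    using assms unfolding s_def by (auto simp: algebra_simps)
  have c: "sqrt (2 * (real p + 1) / real p) = sqrt 2 * s / sqrt (real p)"
    unfolding s_def by (simp only: real_sqrt_mult real_sqrt_divide)
  have x: "sqrt 2 * s / sqrt (real p) * (sqrt 2 / 2) = s / sqrt (real p)"
  proof -
    have "sqrt 2 * s / sqrt (real p) * (sqrt 2 / 2) = (sqrt 2 * sqrt 2) * s / (2 * sqrt (real p))"
      by (simp only: times_divide_times_eq mult.commute mult.left_commute)
    then show ?thesis
      by simp
  qed
  have "sqrt 2 * s / sqrt (real p) * ((s + 1) / (sqrt 2 * real p))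
      = s / sqrt (real p) * ((s + 1) / real p)"
    by simp
  \<comment> \<open>The factorization \<open>p = (s - 1) * (s + 1)\<close> turns the
    \<open>J\<close> coefficient of \<open>M_mat p\<close> into \<open>s\<close> times that of
    \<open>M_star p\<close>.\<close>
  also have "(s + 1) / real p = 1 / (s - 1)"
    unfolding s(2) using s(1) by simp
  finally have y: "sqrt 2 * s / sqrt (real p) * ((s + 1) / (sqrt 2 * real p))
      = s / (sqrt (real p) * (s - 1))"
    by simp
  show ?thesis
    unfolding M_mat_def c s_def[symmetric]
  proof (rule eq_matI, goal_cases)
    case (1 i j)
    have "sqrt 2 * s / sqrt (real p) * (sqrt 2 / 2 * d - (s + 1) / (sqrt 2 * real p))
        = s / sqrt (real p) * d - s / (sqrt (real p) * (s - 1))" for d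
      unfolding right_diff_distrib y mult.assoc[symmetric] x ..
    from this[of "if i = j then 1 else 0"] 1 show ?case
      by (simp add: J_mat_def)
  qed (auto simp: J_mat_def)
qed

text \<open>The \<open>J\<close> term here is \<open>s\<close> times the one in
  \<open>M_star p\<close>. Shifting every entry by \<open>T\<close> compensates: it adds
  \<open>s * (s - 1) * T\<close> to the numerator, while the coordinate sum grows from
  \<open>T\<close> to \<open>s * s * T\<close>.\<close>

lemma int_row_comb_scaled_M_mat:
  assumes "0 < p" "b \<in> carrier_vec p"
  shows "int_row_comb b (sqrt (2 * (real p + 1) / real p) \<cdot>\<^sub>m M_mat p)
    = int_row_comb (vec p (\<lambda>i. b $ i + (\<Sum>k<p. b $ k))) (M_star p)"
    (is "?l = int_row_comb ?a _")
proof (rule eq_vecI)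
  define s where "s = sqrt (real p + 1)"
  define T where "T = real_of_int (\<Sum>k<p. b $ k)"
  have s: "s > 1" "s * s = real p + 1"
    using assms unfolding s_def by auto
  fix i assume "i < dim_vec (int_row_comb ?a (M_star p))"
  then have i: "i < p"
    using carrier_vecD[OF int_row_comb_M_star_carrier] by simp
  \<comment> \<open>Writing \<open>p + 1\<close> as \<open>s * s\<close> makes the remaining
    comparison a polynomial identity in \<open>s\<close>.\<close>
  have S: "real_of_int (\<Sum>k<p. ?a $ k) = s * s * T"
    unfolding s(2) T_def by (simp add: sum.distrib algebra_simps)
  have "?l $ i = s / sqrt (real p) * real_of_int (b $ i) - s / (sqrt (real p) * (s - 1)) * T"
    unfolding scaled_M_mat[OF assms(1)] int_row_comb_I_J_nth[OF assms(2) i] s_def T_def ..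
  also have "\<dots> = (s * (s - 1) * real_of_int (b $ i) - s * T) / (sqrt (real p) * (s - 1))"
    using s(1) by (simp add: diff_divide_distrib)
  also have "s * (s - 1) * real_of_int (b $ i) - s * T
      = s * (s - 1) * (real_of_int (b $ i) + T) - s * s * T"
    by (simp add: algebra_simps)
  also have "\<dots> / (sqrt (real p) * (s - 1)) = int_row_comb ?a (M_star p) $ i"
    unfolding int_row_comb_M_star_nth[OF vec_carrier i] S
    using i by (simp add: s_def T_def)
  finally show "?l $ i = int_row_comb ?a (M_star p) $ i" .
qed (auto simp: int_row_comb_def M_mat_def J_mat_def M_star_def)

text \<open>The shift \<open>b \<mapsto> b + T 1\<close> maps the integer vectors onto those whose
  coordinate sum is divisible by \<open>p + 1\<close>.\<close>

lemma lattice_scaled_M_mat: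
  assumes "0 < p"
  shows "lattice_of_mat (sqrt (2 * (real p + 1) / real p) \<cdot>\<^sub>m M_mat p)
    = (\<lambda>a. int_row_comb a (M_star p)) ` {a \<in> carrier_vec p. (int p + 1) dvd (\<Sum>i<p. a $ i)}"
    (is "lattice_of_mat ?G = ?f ` ?A")
proof -
  have dim: "dim_row ?G = p"
    by (simp add: M_mat_def J_mat_def)
  show ?thesis
    unfolding lattice_of_mat_def dim
  proof safe
    fix b :: "int vec" assume b: "b \<in> carrier_vec p"
    have "(\<Sum>i<p. b $ i + (\<Sum>k<p. b $ k)) = (int p + 1) * (\<Sum>k<p. b $ k)"
      by (simp add: sum.distrib algebra_simps)
    then have "vec p (\<lambda>i. b $ i + (\<Sum>k<p. b $ k)) \<in> ?A"
      by simp
    then show "int_row_comb b ?G \<in> ?f ` ?A"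
      unfolding int_row_comb_scaled_M_mat[OF assms b] by (rule imageI)
  next
    fix a :: "int vec" assume a: "a \<in> carrier_vec p" and "int p + 1 dvd (\<Sum>i<p. a $ i)"
    then obtain T where T: "(\<Sum>i<p. a $ i) = (int p + 1) * T"
      by (auto elim: dvdE)
    \<comment> \<open>Undo the shift: subtracting \<open>T\<close> from each of the \<open>p\<close>
      entries lowers the sum from \<open>(p + 1) * T\<close> to \<open>T\<close>, so
      \<open>T\<close> is again the coordinate sum of \<open>b\<close>.\<close>
    define b where "b = vec p (\<lambda>i. a $ i - T)"
    have b: "b \<in> carrier_vec p"
      by (simp add: b_def)
    have "(\<Sum>k<p. b $ k) = T"
      using T by (simp add: b_def sum_subtractf algebra_simps)
    then have "vec p (\<lambda>i. b $ i + (\<Sum>k<p. b $ k)) = a"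
      using a by (intro eq_vecI) (auto simp: b_def)
    then have "?f a = int_row_comb b ?G"
      using int_row_comb_scaled_M_mat[OF assms b] by simp
    with b show "\<exists>b. ?f a = int_row_comb b ?G \<and> b \<in> carrier_vec p"
      by blast
  qed
qed

section \<open>Cosets of \<open>K\<close> as residue classes of the coordinate sum\<close>

lemma u_vec_carrier: "u_vec p j \<in> carrier_vec p"
  by (simp add: u_vec_def)

lemma sum_u_vec:
  assumes "j \<le> p"
  shows "(\<Sum>i<p. u_vec p j $ i) = int j"
proof -
  have "{..<p} \<inter> {i. i < j} = {..<j}"
    using assms by auto
  then show ?thesis
    by (simp add: u_vec_def sum.If_cases)
qed

text \<open>By additivity, translating by the image of \<open>u_vec p j\<close> adds
  \<open>j\<close> to the coordinate sum, moving the class of residue 0 onto the class of residue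
  \<open>j\<close>.\<close>

lemma translate_u_vec:
  assumes "0 < p" "j \<le> p"
  shows "lattice_of_mat (sqrt (2 * (real p + 1) / real p) \<cdot>\<^sub>m M_mat p)
      \<oplus>\<^sub>t int_row_comb (u_vec p j) (M_star p)
    = (\<lambda>a. int_row_comb a (M_star p)) `
        {a \<in> carrier_vec p. (\<Sum>i<p. a $ i) mod (int p + 1) = int j}"
    (is "?K \<oplus>\<^sub>t ?f ?u = ?f ` ?B")
proof -
  \<comment> \<open>From \<open>j \<le> p\<close>, the number \<open>j\<close> is its own residue
    modulo \<open>p + 1\<close>.\<close>
  have mod_iff: "(int p + 1) dvd (x - int j) \<longleftrightarrow> x mod (int p + 1) = int j" for x
    using assms(2) mod_eq_dvd_iff[of x "int p + 1" "int j"] by simp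
  note u = u_vec_carrier[of p j]
  show ?thesis
    unfolding translate_def lattice_scaled_M_mat[OF assms(1)]
  proof safe
    fix a :: "int vec" assume a: "a \<in> carrier_vec p" and dvd: "(int p + 1) dvd (\<Sum>i<p. a $ i)"
    have "(\<Sum>i<p. (a + ?u) $ i) - int j = (\<Sum>i<p. a $ i)"
      using a u sum_u_vec[OF assms(2)] by (simp add: sum.distrib)
    then have "a + ?u \<in> ?B"
      using a u dvd mod_iff[of "\<Sum>i<p. (a + ?u) $ i"] by simp
    then show "?f a + ?f ?u \<in> ?f ` ?B"
      unfolding int_row_comb_add[OF M_star_carrier a u, symmetric] by (rule imageI)
  next
    fix a :: "int vec"
    assume a: "a \<in> carrier_vec p" and m: "(\<Sum>i<p. a $ i) mod (int p + 1) = int j"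
    have d: "a - ?u \<in> carrier_vec p"
      using a u by simp
    have "(\<Sum>i<p. (a - ?u) $ i) = (\<Sum>i<p. a $ i) - int j"
      using a u sum_u_vec[OF assms(2)] by (simp add: sum_subtractf)
    then have dvd: "(int p + 1) dvd (\<Sum>i<p. (a - ?u) $ i)"
      using m mod_iff by simp
    have "a - ?u + ?u = a"
      using a u by (intro eq_vecI) auto
    then have "?f a = ?f (a - ?u) + ?f ?u"
      using int_row_comb_add[OF M_star_carrier d u] by simp
    with d dvd show "\<exists>k. ?f a = k + ?f ?u
        \<and> k \<in> ?f ` {a \<in> carrier_vec p. (int p + 1) dvd (\<Sum>i<p. a $ i)}"
      by blast
  qed
qed

theorem proposition1:
  fixes p :: nat and L K :: "real vec set"
  assumes p_pos: "0 < p"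
    and L_eq: "L = lattice_of_mat (M_star p)"
    and K_eq: "K = lattice_of_mat (sqrt (2 * (real p + 1) / real p) \<cdot>\<^sub>m M_mat p)"
  shows "(\<forall>a :: int vec. \<forall>z :: nat.
            a \<in> carrier_vec p \<longrightarrow> int z = (\<Sum>i<p. a $ i) mod (int p + 1) \<longrightarrow>
            int_row_comb a (M_star p) \<in> K \<oplus>\<^sub>t int_row_comb (u_vec p z) (M_star p))
       \<and> partition_on L {K \<oplus>\<^sub>t int_row_comb (u_vec p j) (M_star p) | j. j \<in> {0..p}}
       \<and> card {K \<oplus>\<^sub>t int_row_comb (u_vec p j) (M_star p) | j. j \<in> {0..p}} = p + 1"
proof -
  define f where "f = (\<lambda>a. int_row_comb a (M_star p))"
  define B where "B = (\<lambda>j. {a :: int vec. a \<in> carrier_vec p \<and> (\<Sum>i<p. a $ i) mod (int p + 1) = int j})"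
  have inj: "inj_on f (carrier_vec p)"
    unfolding f_def by (rule inj_on_int_row_comb_M_star[OF p_pos])
  have coset: "K \<oplus>\<^sub>t int_row_comb (u_vec p j) (M_star p) = f ` B j" if "j \<le> p" for j
    unfolding K_eq translate_u_vec[OF p_pos that] f_def B_def ..
  have L: "L = f ` carrier_vec p"
    using M_star_carrier[of p] unfolding L_eq lattice_of_mat_def f_def by auto
  have residue: "\<exists>j\<le>p. x mod (int p + 1) = int j" for x :: int
    using pos_mod_bound[of "int p + 1" x] pos_mod_sign[of "int p + 1" x]
    by (intro exI[of _ "nat (x mod (int p + 1))"]) auto
  \<comment> \<open>Each class contains its own representative, so no coset is empty.\<close>
  have "u_vec p j \<in> B j" if "j \<le> p" for j
    using that by (simp add: B_def u_vec_carrier sum_u_vec)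
  then have nonempty: "f ` B j \<noteq> {}" if "j \<le> p" for j
    using that by blast
  \<comment> \<open>The classes \<open>B i\<close> and \<open>B j\<close> are disjoint, and an
    injective map preserves this for their images.\<close>
  have disj: "f ` B i \<inter> f ` B j = {}" if "i \<noteq> j" for i j
  proof -
    have "B i \<inter> B j = {}" "B i \<subseteq> carrier_vec p" "B j \<subseteq> carrier_vec p"
      using that by (auto simp: B_def)
    then show ?thesis
      using inj_on_image_Int[OF inj] by blast
  qed
  have cosets: "{K \<oplus>\<^sub>t int_row_comb (u_vec p j) (M_star p) | j. j \<in> {0..p}} = (\<lambda>j. f ` B j) ` {0..p}"
    (is "?P = _") unfolding Setcompr_eq_image by (rule image_cong) (simp_all add: coset)
  have member: "int_row_comb a (M_star p) \<in> K \<oplus>\<^sub>t int_row_comb (u_vec p z) (M_star p)"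
    if a: "a \<in> carrier_vec p" and z: "int z = (\<Sum>i<p. a $ i) mod (int p + 1)" for a z
  proof -
    \<comment> \<open>As a residue modulo \<open>p + 1\<close>, \<open>z\<close> lies in the range
      of indices for which \<open>coset\<close> holds.\<close>
    have "z \<le> p"
      using residue[of "\<Sum>i<p. a $ i"] unfolding z[symmetric] by simp
    moreover have "a \<in> B z"
      using a z by (simp add: B_def)
    ultimately show ?thesis
      using coset by (simp add: f_def)
  qed
  have "partition_on L ?P"
    unfolding cosets
  proof (rule partition_onI)
    have "(\<Union>j\<in>{0..p}. B j) = carrier_vec p"
      unfolding B_def using residue by (auto simp: Bex_def)
    then show "\<Union> ((\<lambda>j. f ` B j) ` {0..p}) = L"
      unfolding L by (metis image_UN)
  next
    fix X Y assume "X \<in> (\<lambda>j. f ` B j) ` {0..p}" "Y \<in> (\<lambda>j. f ` B j) ` {0..p}" "X \<noteq> Y"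
    then obtain i j where "X = f ` B i" "Y = f ` B j" "i \<noteq> j"
      by (elim imageE) metis
    then show "disjnt X Y"
      using disj[of i j] unfolding disjnt_def by simp
  next
    show "{} \<notin> (\<lambda>j. f ` B j) ` {0..p}"
      using nonempty by fastforce
  qed
  \<comment> \<open>The cosets form a set, so counting \<open>p + 1\<close> of them requires
    different indices to give different cosets; this holds because they are disjoint and
    nonempty.\<close>
  moreover have "inj_on (\<lambda>j. f ` B j) {0..p}"
  proof (rule inj_onI)
    fix i j assume "i \<in> {0..p}" "f ` B i = f ` B j"
    then show "i = j"
      using disj[of i j] nonempty[of i] by (cases "i = j") simp_all
  qed
  then have "card ?P = p + 1"
    unfolding cosets by (simp add: card_image)
  ultimately show ?thesis
    using member by simp
qed

end
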